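(* Let $\Omega\subset\mathbb{R}^n$ be a bounded $\mu$-measurable set, where $\mu$ is a lower Ahlfors $\beta$-regular measure in $\Omega$. Let $0<\alpha<\beta$ and $0<\epsilon<\min\{\alpha,\ \beta-\alpha\}$. Then there is a constant $C>0$ such that $$|I_\alpha f(x)|\le C\big(M_{\alpha+\epsilon}f(x)\,M_{\alpha-\epsilon}f(x)\big)^{1/2}$$ holds for every locally integrable function $f$ supported in $\Omega$ and every $x\in\Omega$.
   Context: $\mu$ is a non-negative Borel regular measure on $\mathbb{R}^n$. $Q=Q(x,l(Q))$ denotes a cube centered at $x$ with side length $l(Q)$ and sides parallel to the coordinate axes. The measure $\mu$ is lower Ahlfors $\beta$-regular in the bounded set $\Omega$ ($\beta>0$ a constant) if there is $c>0$ with $\mu(Q(x,l(Q)))\ge c\,l(Q)^{\beta}$ for every $x\in\Omega$ and every cube $Q=Q(x,l(Q))$ with $0<l(Q)<\mathrm{diam}(\Omega)$. For $0\le\gamma<\beta$ the centered fractional maximal function is $$M_\gamma f(x)=\sup_{\rho>0}\frac{1}{\mu(Q(x,\rho))^{1-\gamma/\beta}}\int_{Q(x,\rho)}|f(y)|\,d\mu(y),$$ and the fractional integral operator is $$I_\alpha f(x)=\int_\Omega\frac{f(y)\,|x-y|^{\alpha}}{\mu(Q(x,2|x-y|))}\,d\mu(y).$$ *)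

theory Defs
  imports "HOL-Analysis.Analysis"
begin

text \<open>
  A Borel regular outer measure on \<open>\<real>\<^sup>n\<close> enters as a measure on its \<open>\<sigma>\<close>-algebra of measurable
  sets. That \<open>\<sigma>\<close>-algebra may be strictly larger than the Borel one, so it is left open; a
  \<open>\<mu>\<close>-measurable set is an element of \<open>sets M\<close>. Since \<open>UNIV\<close> is Borel, the first conjunct
  forces \<open>space M = UNIV\<close>. No finiteness of any kind is imposed.
\<close>

definition borel_regular :: "'a::topological_space measure \<Rightarrow> bool" where
  "borel_regular M \<longleftrightarrow>
     sets borel \<subseteq> sets M \<and>
     (\<forall>A\<in>sets M. \<exists>B\<in>sets borel. A \<subseteq> B \<and> emeasure M B = emeasure M A)"

text \<open>
  Cubes are closed and \<open>l\<close> is the full side length, so \<open>y \<in> cube x (2 * norm (x - y))\<close>.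
\<close>

definition cube :: "real^'n \<Rightarrow> real \<Rightarrow> (real^'n) set" where
  "cube x l = {y. \<forall>i. \<bar>y $ i - x $ i\<bar> \<le> l / 2}"

definition lower_Ahlfors_regular :: "(real^'n) measure \<Rightarrow> real \<Rightarrow> (real^'n) set \<Rightarrow> bool" where
  "lower_Ahlfors_regular M \<beta> \<Omega> \<longleftrightarrow>
     (\<exists>c>0. \<forall>x\<in>\<Omega>. \<forall>l. 0 < l \<and> l < diameter \<Omega> \<longrightarrow>
        ennreal (c * l powr \<beta>) \<le> emeasure M (cube x l))"

definition locally_integrable :: "'a::topological_space measure \<Rightarrow> ('a \<Rightarrow> real) \<Rightarrow> bool" where
  "locally_integrable M f \<longleftrightarrow>
     f \<in> borel_measurable M \<and> (\<forall>K. compact K \<longrightarrow> set_integrable M K f)"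

text \<open>Real powers on \<open>[0, \<infinity>]\<close>, meant for exponents \<open>p > 0\<close>.\<close>

definition ennreal_powr :: "ennreal \<Rightarrow> real \<Rightarrow> ennreal" where
  "ennreal_powr a p = (if a = \<infinity> then \<infinity> else ennreal (enn2real a powr p))"

text \<open>
  The maximal function takes values in \<open>[0, \<infinity>]\<close>. It depends on \<open>\<beta>\<close> as well as \<open>\<gamma>\<close>, and is
  meant for \<open>0 \<le> \<gamma> < \<beta>\<close>. A cube of measure zero contributes \<open>0 / 0 = 0\<close>; a cube of infinite
  measure contributes \<open>0\<close>.
\<close>

definition frac_maximal ::
    "(real^'n) measure \<Rightarrow> real \<Rightarrow> real \<Rightarrow> (real^'n \<Rightarrow> real) \<Rightarrow> real^'n \<Rightarrow> ennreal" where
  "frac_maximal M \<beta> \<gamma> f x =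
     (SUP \<rho>\<in>{0<..}. (\<integral>\<^sup>+y\<in>cube x \<rho>. ennreal \<bar>f y\<bar> \<partial>M)
                     / ennreal_powr (emeasure M (cube x \<rho>)) (1 - \<gamma> / \<beta>))"

text \<open>
  The Lebesgue integral with values in \<open>[-\<infinity>, \<infinity>]\<close>, i.e. the integral of the positive part minus
  that of the negative part (\<open>e2ennreal\<close> truncates negative arguments to \<open>0\<close>). The Bochner
  integral is unsuitable here: it is \<open>0\<close> for non-integrable functions, which would turn an upper
  bound on it into a void statement. In the undefined case, \<open>\<infinity> - \<infinity> = \<infinity>\<close> in \<open>ereal\<close>.
\<close>

definition ext_set_integral :: "'a measure \<Rightarrow> 'a set \<Rightarrow> ('a \<Rightarrow> ereal) \<Rightarrow> ereal" where
  "ext_set_integral M A g =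
     enn2ereal (\<integral>\<^sup>+y\<in>A. e2ennreal (g y) \<partial>M) - enn2ereal (\<integral>\<^sup>+y\<in>A. e2ennreal (- g y) \<partial>M)"

text \<open>For \<open>\<alpha> > 0\<close> the integrand is \<open>0\<close> at \<open>y = x\<close>, also when \<open>M\<close> has no mass at \<open>x\<close>.\<close>

definition frac_integral ::
    "(real^'n) measure \<Rightarrow> (real^'n) set \<Rightarrow> real \<Rightarrow> (real^'n \<Rightarrow> real) \<Rightarrow> real^'n \<Rightarrow> ereal" where
  "frac_integral M \<Omega> \<alpha> f x =
     ext_set_integral M \<Omega>
       (\<lambda>y. ereal (f y * norm (x - y) powr \<alpha>)
             / enn2ereal (emeasure M (cube x (2 * norm (x - y)))))"

end

theory Submission
  imports Defs
begin

text \<open>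
  This is Hedberg's splitting argument, but in a form that survives without any doubling
  condition. Fix \<open>x\<close> and let \<open>\<phi>(y)\<close> be the mass of the cube \<open>Q(x, 2|x - y|)\<close>. Lower
  Ahlfors regularity gives \<open>|x - y|\<^sup>\<alpha> \<le> D \<phi>(y)\<^bsup>\<alpha>/\<beta>\<^esup>\<close>, so the kernel is at most
  \<open>D \<phi>(y)\<^bsup>-p\<^esup>\<close> with \<open>p = 1 - \<alpha>/\<beta>\<close>, and it remains to bound \<open>\<integral> |f| \<phi>\<^bsup>-p\<^esup> d\<mu>\<close>.

  The usual decomposition into annuli \<open>|x - y| \<approx> 2\<^sup>k\<close> would compare the masses of two
  concentric cubes, which nothing controls here. Instead the space is cut into the layers
  \<open>s < \<phi> \<le> 2s\<close>. The sublevel set \<open>{0 < \<phi> \<le> 2s}\<close> lies in an increasing union of cubes about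
  \<open>x\<close> of mass at most \<open>2s\<close>, so the definition of the maximal function bounds the integral of
  \<open>|f|\<close> over it by \<open>M\<^sub>\<gamma> f(x) (2s)\<^bsup>1 - \<gamma>/\<beta>\<^esup>\<close> (\<open>sublevel_integral_le_frac_maximal\<close>). With
  \<open>\<delta> = \<epsilon>/\<beta>\<close>, a layer therefore contributes at most \<open>K M\<^bsub>\<alpha>-\<epsilon>\<^esub> f(x) s\<^sup>\<delta>\<close>
  (take \<open>\<gamma> = \<alpha> - \<epsilon>\<close>) and also at most \<open>K M\<^bsub>\<alpha>+\<epsilon>\<^esub> f(x) s\<^bsup>-\<delta>\<^esup>\<close> (take \<open>\<gamma> = \<alpha> + \<epsilon>\<close>).

  Use the first bound for the layers below a threshold \<open>t\<close> and the second above it. Both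
  geometric series are dominated by their terms next to the threshold, which yields
  \<open>M\<^bsub>\<alpha>-\<epsilon>\<^esub> f(x) t\<^sup>\<delta> + M\<^bsub>\<alpha>+\<epsilon>\<^esub> f(x) t\<^bsup>-\<delta>\<^esup>\<close> up to a constant (\<open>dyadic_layers_sum\<close>); the
  choice of \<open>t\<close> that makes the two terms equal turns this into twice the geometric mean
  (\<open>dyadic_layers_interpolate\<close>).
\<close>

section \<open>Cubes and their masses\<close>

text \<open>
  Lets a union over uncountably many radii be replaced by an increasing sequence. The
  subtle case is a supremum that is attained: an arbitrary sequence converging to it need not
  reach it, and the constant sequence is taken instead.
\<close>

lemma countable_cofinal_incseq:
  fixes S :: "real set"
  assumes "S \<noteq> {}"
  shows "\<exists>r::nat \<Rightarrow> real. incseq r \<and> range r \<subseteq> S \<and> (\<forall>s\<in>S. \<exists>n. s \<le> r n)"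
proof -
  have "ereal ` S \<noteq> {}" using assms by simp
  from Sup_countable_SUP[OF this] obtain g :: "nat \<Rightarrow> ereal"
    where g: "incseq g" "range g \<subseteq> ereal ` S" "Sup (ereal ` S) = (SUP i. g i)"
    by blast
  have "\<forall>n. \<exists>s\<in>S. g n = ereal s" using g(2) by blast
  then obtain r where r: "\<And>n. r n \<in> S" "\<And>n. g n = ereal (r n)" by metis
  have inc: "incseq r" using g(1) r(2) by (simp add: mono_def)
  show ?thesis
  proof (cases "\<exists>m\<in>S. \<forall>s\<in>S. s \<le> m")
    case True
    then obtain m where "m \<in> S" "\<forall>s\<in>S. s \<le> m" by blast
    then show ?thesis by (intro exI[of _ "\<lambda>_. m"]) (auto simp: mono_def)
  next
    case False
    have "\<exists>n. s \<le> r n" if "s \<in> S" for s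
    proof -
      obtain u where u: "u \<in> S" "s < u" using False \<open>s \<in> S\<close> by (meson not_le)
      have "ereal s < Sup (ereal ` S)"
        using u by (meson Sup_upper image_eqI ereal_less(2) less_le_trans less_ereal.simps(1))
      then obtain n where "ereal s < g n" using g(3) by (auto simp: less_SUP_iff)
      then show ?thesis using r(2) by (metis less_ereal.simps(1) less_imp_le)
    qed
    then show ?thesis using inc r(1) by blast
  qed
qed

lemma borel_measurable_mono_ennreal:
  fixes g :: "real \<Rightarrow> ennreal"
  assumes "mono g"
  shows "g \<in> borel_measurable borel"
proof (rule borel_measurableI_le)
  fix a
  have "is_interval {w \<in> space borel. g w \<le> a}"
    unfolding is_interval_1 using monoD[OF assms] by (auto intro: order_trans)
  then show "{w \<in> space borel. g w \<le> a} \<in> sets borel"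
    by (rule real_interval_borel_measurable)
qed

lemma closed_cube: "closed (cube x l)"
  unfolding cube_def by (intro closed_Collect_all closed_Collect_le continuous_intros)

lemma cube_mono: "l \<le> l' \<Longrightarrow> cube x l \<subseteq> cube x l'"
  unfolding cube_def by (auto intro: order_trans)

lemma mem_cube_norm: "y \<in> cube x (2 * norm (x - y))"
  unfolding cube_def using component_le_norm_cart[of "x - y"] by (auto simp: abs_minus_commute)

text \<open>
  The value at \<open>y = x\<close> is set to \<open>0\<close>, because \<open>{x}\<close> may be an atom while the maximal function
  sees only cubes of positive side length: if those have infinite mass, it does not control
  \<open>f x\<close>. The kernel vanishes at \<open>x\<close>, so nothing is lost. A cube of infinite mass also gets
  the value \<open>0\<close>, in accordance with the kernel being \<open>0\<close> there.
\<close>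

definition cube_mass :: "(real^'n) measure \<Rightarrow> real^'n \<Rightarrow> real^'n \<Rightarrow> real" where
  "cube_mass M x y = (if y = x then 0 else enn2real (emeasure M (cube x (2 * norm (x - y)))))"

lemma cube_mass_nonneg [simp]: "0 \<le> cube_mass M x y"
  by (simp add: cube_mass_def)

lemma space_UNIV_of_borel_sub:
  assumes "sets borel \<subseteq> sets M"
  shows "space M = UNIV"
proof -
  have "UNIV \<in> sets M" using assms sets.top[of borel] by auto
  then show ?thesis using sets.sets_into_space by blast
qed

lemma measurable_of_borel_sub:
  assumes "sets borel \<subseteq> sets M" "f \<in> borel_measurable borel"
  shows "f \<in> borel_measurable M"
  using assms space_UNIV_of_borel_sub[OF assms(1)] unfolding measurable_def by auto

lemma borel_measurable_cube_mass:
  assumes B: "sets borel \<subseteq> sets M"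
  shows "cube_mass M x \<in> borel_measurable M"
proof -
  have "mono (\<lambda>r::real. emeasure M (cube x (2 * r)))"
    using B borel_closed[OF closed_cube] by (intro monoI emeasure_mono cube_mono) auto
  note [measurable] = borel_measurable_mono_ennreal[OF this]
  have "(\<lambda>y. if y = x then 0 else enn2real ((\<lambda>r. emeasure M (cube x (2 * r))) (norm (x - y))))
      \<in> borel_measurable borel"
    by measurable
  then show ?thesis
    unfolding cube_mass_def by (rule measurable_of_borel_sub[OF B])
qed

section \<open>The maximal function on layers of the cube mass\<close>

lemma cube_integral_le_frac_maximal:
  assumes "0 < l" "emeasure M (cube x l) = ennreal v" "0 < v"
  shows "(\<integral>\<^sup>+y\<in>cube x l. ennreal \<bar>f y\<bar> \<partial>M) \<le> frac_maximal M \<beta> \<gamma> f x * ennreal (v powr (1 - \<gamma> / \<beta>))"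
proof -
  have p: "ennreal_powr (emeasure M (cube x l)) (1 - \<gamma> / \<beta>) = ennreal (v powr (1 - \<gamma> / \<beta>))"
    using assms by (simp add: ennreal_powr_def)
  let ?I = "\<integral>\<^sup>+y\<in>cube x l. ennreal \<bar>f y\<bar> \<partial>M" and ?v = "ennreal (v powr (1 - \<gamma> / \<beta>))"
  have "?I / ?v \<le> frac_maximal M \<beta> \<gamma> f x"
    unfolding frac_maximal_def using assms(1) by (intro SUP_upper2[of l]) (auto simp: p)
  then have "?I / ?v * ?v \<le> frac_maximal M \<beta> \<gamma> f x * ?v" by (rule mult_right_mono) simp
  moreover have "?I / ?v * ?v = ?I"
    using assms(3) by (simp add: ennreal_divide_times)
  ultimately show ?thesis by simp
qed

text \<open>
  The sublevel set is covered by the cubes through its own points. These are nested and each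
  of them has mass at most \<open>t\<close>, so the bound passes to their union by continuity from below,
  even though that union need not be a cube and may leave every bounded set.
\<close>

lemma sublevel_integral_le_frac_maximal:
  assumes B: "sets borel \<subseteq> sets M" and f: "f \<in> borel_measurable M"
    and q: "0 \<le> 1 - \<gamma> / \<beta>"
  shows "(\<integral>\<^sup>+y. ennreal \<bar>f y\<bar> * indicator {y. 0 < cube_mass M x y \<and> cube_mass M x y \<le> t} y \<partial>M)
    \<le> frac_maximal M \<beta> \<gamma> f x * ennreal (t powr (1 - \<gamma> / \<beta>))"
proof -
  define A where "A = {y. 0 < cube_mass M x y \<and> cube_mass M x y \<le> t}"
  show ?thesis
  proof (cases "A = {}")
    case True
    then show ?thesis unfolding A_def by simp
  next
    case False
    then have "(\<lambda>y. norm (x - y)) ` A \<noteq> {}" by simp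
    from countable_cofinal_incseq[OF this] obtain r where r: "incseq r"
      "range r \<subseteq> (\<lambda>y. norm (x - y)) ` A" "\<And>y. y \<in> A \<Longrightarrow> \<exists>n. norm (x - y) \<le> r n"
      by blast
    define N where "N = density M (\<lambda>y. ennreal \<bar>f y\<bar>)"
    have cM: "cube x l \<in> sets M" for l using B borel_closed[OF closed_cube] by auto
    have N: "emeasure N X = (\<integral>\<^sup>+y\<in>X. ennreal \<bar>f y\<bar> \<partial>M)" if "X \<in> sets M" for X
      unfolding N_def using f that by (intro emeasure_density) auto
    have cov: "A \<subseteq> (\<Union>n. cube x (2 * r n))"
    proof
      fix y assume "y \<in> A"
      then obtain n where "norm (x - y) \<le> r n" using r(3) by blast
      then show "y \<in> (\<Union>n. cube x (2 * r n))"
        using mem_cube_norm[of y x] cube_mono[of "2 * norm (x - y)" "2 * r n" x] by auto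
    qed
    have "(\<integral>\<^sup>+y. ennreal \<bar>f y\<bar> * indicator A y \<partial>M)
        \<le> (\<integral>\<^sup>+y\<in>(\<Union>n. cube x (2 * r n)). ennreal \<bar>f y\<bar> \<partial>M)"
      using cov by (intro nn_integral_mono mult_left_mono) (auto split: split_indicator)
    also have "\<dots> = emeasure N (\<Union>n. cube x (2 * r n))"
      using cM by (intro N[symmetric]) auto
    also have "\<dots> = (SUP n. emeasure N (cube x (2 * r n)))"
    proof (rule SUP_emeasure_incseq[symmetric])
      show "range (\<lambda>n. cube x (2 * r n)) \<subseteq> sets N" using cM by (auto simp: N_def)
      show "incseq (\<lambda>n. cube x (2 * r n))"
        using r(1) by (intro monoI cube_mono) (simp add: monoD)
    qed
    also have "\<dots> \<le> frac_maximal M \<beta> \<gamma> f x * ennreal (t powr (1 - \<gamma> / \<beta>))"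
    proof (rule SUP_least)
      fix n
      obtain y where y: "y \<in> A" "r n = norm (x - y)" using r(2) by blast
      let ?v = "cube_mass M x y"
      have v: "0 < ?v" "?v \<le> t" using y(1) by (auto simp: A_def)
      have "y \<noteq> x" using v(1) by (auto simp: cube_mass_def)
      then have l: "0 < 2 * r n" and em: "emeasure M (cube x (2 * r n)) = ennreal ?v"
        using v(1) ennreal_enn2real_if by (auto simp: cube_mass_def y(2) split: if_splits)
      have "emeasure N (cube x (2 * r n)) \<le> frac_maximal M \<beta> \<gamma> f x * ennreal (?v powr (1 - \<gamma> / \<beta>))"
        unfolding N[OF cM] by (rule cube_integral_le_frac_maximal[OF l em v(1)])
      also have "\<dots> \<le> frac_maximal M \<beta> \<gamma> f x * ennreal (t powr (1 - \<gamma> / \<beta>))"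
        using v q by (intro mult_left_mono ennreal_leI powr_mono2) auto
      finally show "emeasure N (cube x (2 * r n))
          \<le> frac_maximal M \<beta> \<gamma> f x * ennreal (t powr (1 - \<gamma> / \<beta>))" .
    qed
    finally show ?thesis by (simp add: A_def)
  qed
qed


lemma dyadic_layer_integral_le:
  assumes B: "sets borel \<subseteq> sets M" and f: "f \<in> borel_measurable M"
    and q: "0 \<le> 1 - \<gamma> / \<beta>" and p: "0 \<le> p" and s: "0 < s"
  shows "(\<integral>\<^sup>+y. ennreal (\<bar>f y\<bar> * cube_mass M x y powr - p)
            * indicator {y. s < cube_mass M x y \<and> cube_mass M x y \<le> 2 * s} y \<partial>M)
    \<le> frac_maximal M \<beta> \<gamma> f x * ennreal (2 powr (1 - \<gamma> / \<beta>) * s powr (1 - \<gamma> / \<beta> - p))"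
    (is "?L \<le> _")
proof -
  let ?q = "1 - \<gamma> / \<beta>"
  let ?A = "{y. 0 < cube_mass M x y \<and> cube_mass M x y \<le> 2 * s}"
  have [measurable]: "?A \<in> sets M"
  proof -
    have "{y \<in> space M. 0 < cube_mass M x y \<and> cube_mass M x y \<le> 2 * s} \<in> sets M"
      using borel_measurable_cube_mass[OF B, of x] by measurable
    then show ?thesis by (simp add: space_UNIV_of_borel_sub[OF B])
  qed
  note f[measurable]
  have "?L \<le> (\<integral>\<^sup>+y. ennreal (s powr - p) * (ennreal \<bar>f y\<bar> * indicator ?A y) \<partial>M)"
  proof (rule nn_integral_mono)
    fix y
    show "ennreal (\<bar>f y\<bar> * cube_mass M x y powr - p)
            * indicator {y. s < cube_mass M x y \<and> cube_mass M x y \<le> 2 * s} y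
        \<le> ennreal (s powr - p) * (ennreal \<bar>f y\<bar> * indicator ?A y)"
    proof (cases "s < cube_mass M x y \<and> cube_mass M x y \<le> 2 * s")
      case True
      then have "cube_mass M x y powr - p \<le> s powr - p"
        using s p by (intro powr_mono2') auto
      then have "\<bar>f y\<bar> * cube_mass M x y powr - p \<le> s powr - p * \<bar>f y\<bar>"
        by (subst mult.commute) (rule mult_right_mono, auto)
      then show ?thesis using True s by (simp add: ennreal_mult[symmetric] ennreal_leI)
    qed simp
  qed
  also have "\<dots> = ennreal (s powr - p) * (\<integral>\<^sup>+y. ennreal \<bar>f y\<bar> * indicator ?A y \<partial>M)"
    by (rule nn_integral_cmult) measurable
  also have "\<dots> \<le> ennreal (s powr - p) * (frac_maximal M \<beta> \<gamma> f x * ennreal ((2 * s) powr ?q))"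
    by (intro mult_left_mono sublevel_integral_le_frac_maximal B f q) simp
  also have "\<dots> = frac_maximal M \<beta> \<gamma> f x * ennreal (s powr - p * (2 * s) powr ?q)"
    by (simp add: ennreal_mult mult_ac)
  also have "s powr - p * (2 * s) powr ?q = 2 powr ?q * s powr (?q - p)"
    using s by (simp add: powr_mult powr_diff powr_minus divide_inverse)
  finally show ?thesis .
qed

section \<open>Summing the layers\<close>

lemma dyadic_layer_exists:
  fixes v t :: real
  assumes "0 < v" "0 < t"
  shows "(\<exists>k::nat. t * 2 powr - (real k + 1) < v \<and> v \<le> 2 * (t * 2 powr - (real k + 1))) \<or>
         (\<exists>k::nat. t * 2 powr real k < v \<and> v \<le> 2 * (t * 2 powr real k))"
proof -
  define j where "j = \<lceil>log 2 (v / t)\<rceil> - 1"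
  have "real_of_int j < log 2 (v / t)" "log 2 (v / t) \<le> real_of_int j + 1"
    unfolding j_def by linarith+
  then have "2 powr real_of_int j < v / t" "v / t \<le> 2 powr (real_of_int j + 1)"
    using assms by (simp_all add: less_log_iff log_le_iff)
  then have *: "t * 2 powr real_of_int j < v" "v \<le> 2 * (t * 2 powr real_of_int j)"
    using assms by (simp_all add: field_simps powr_add)
  show ?thesis
  proof (cases "0 \<le> j")
    case True
    then show ?thesis using * by (intro disjI2 exI[of _ "nat j"]) simp
  next
    case False
    then have "real_of_int j = - (real (nat (- j - 1)) + 1)" by simp
    then show ?thesis using * by (intro disjI1 exI[of _ "nat (- j - 1)"]) metis
  qed
qed

lemma suminf_geometric_ennreal:
  fixes c :: ennreal
  assumes "0 \<le> w" "w < 1"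
  shows "(\<Sum>k. c * ennreal (w ^ k)) = c * ennreal (1 / (1 - w))"
proof -
  have "(\<lambda>k. w ^ k) sums (1 / (1 - w))" using assms by (intro geometric_sums) auto
  then have "(\<lambda>k. ennreal (w ^ k)) sums ennreal (1 / (1 - w))" using assms by simp
  from sums_unique[OF this] show ?thesis by simp
qed

text \<open>
  The layers at \<open>t 2\<^bsup>-(k+1)\<^esup>\<close> exhaust \<open>0 < \<phi> \<le> t\<close> and those at \<open>t 2\<^sup>k\<close> exhaust \<open>\<phi> > t\<close>;
  in both directions the contributions decay like powers of \<open>w = 2\<^bsup>-\<delta>\<^esup>\<close>.
\<close>

lemma dyadic_layers_sum:
  fixes \<phi> :: "'a \<Rightarrow> real" and a b :: ennreal
  assumes [measurable]: "\<phi> \<in> borel_measurable N" and \<delta>: "0 < \<delta>" and t: "0 < t"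
    and low: "\<And>s. 0 < s \<Longrightarrow>
        emeasure N {y \<in> space N. s < \<phi> y \<and> \<phi> y \<le> 2 * s} \<le> a * ennreal (s powr \<delta>)"
    and high: "\<And>s. 0 < s \<Longrightarrow>
        emeasure N {y \<in> space N. s < \<phi> y \<and> \<phi> y \<le> 2 * s} \<le> b * ennreal (s powr - \<delta>)"
  shows "emeasure N {y \<in> space N. 0 < \<phi> y}
    \<le> ennreal (1 / (1 - 2 powr - \<delta>)) * (a * ennreal (t powr \<delta>) + b * ennreal (t powr - \<delta>))"
proof -
  define w where "w = 2 powr - \<delta>"
  have w: "0 \<le> w" "w < 1" using \<delta> by (auto simp: w_def powr_less_one)
  define L where "L s = {y \<in> space N. s < \<phi> y \<and> \<phi> y \<le> 2 * s}" for s
  have [measurable]: "L s \<in> sets N" for s unfolding L_def by measurable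
  let ?n = "\<lambda>k::nat. t * 2 powr - (real k + 1)" and ?h = "\<lambda>k::nat. t * 2 powr real k"
  have w_pow: "2 powr - (\<delta> * real k) = w ^ k" for k
    unfolding w_def by (simp add: powr_powr powr_realpow[symmetric])
  have near: "emeasure N (\<Union>k. L (?n k)) \<le> a * ennreal (t powr \<delta>) * ennreal (1 / (1 - w))"
  proof -
    have "emeasure N (\<Union>k. L (?n k)) \<le> (\<Sum>k. emeasure N (L (?n k)))"
      by (rule emeasure_subadditive_countably) auto
    also have "\<dots> \<le> (\<Sum>k. a * ennreal (t powr \<delta>) * ennreal (w ^ k))"
    proof (rule suminf_le)
      fix k
      have "emeasure N (L (?n k)) \<le> a * ennreal ((?n k) powr \<delta>)"
        unfolding L_def using t by (intro low) simp
      also have "(?n k) powr \<delta> = t powr \<delta> * (w ^ k * w)"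
      proof -
        have "(?n k) powr \<delta> = t powr \<delta> * 2 powr (- (\<delta> * real k) + - \<delta>)"
          using t by (simp add: powr_mult powr_powr algebra_simps)
        then show ?thesis by (simp only: powr_add w_pow) (simp add: w_def)
      qed
      also have "a * ennreal (t powr \<delta> * (w ^ k * w)) \<le> a * ennreal (t powr \<delta> * w ^ k)"
        using w by (intro mult_left_mono ennreal_leI mult_left_le) auto
      finally show "emeasure N (L (?n k)) \<le> a * ennreal (t powr \<delta>) * ennreal (w ^ k)"
        using w by (simp add: ennreal_mult mult.assoc)
    qed auto
    finally show ?thesis by (simp only: suminf_geometric_ennreal[OF w])
  qed
  have far: "emeasure N (\<Union>k. L (?h k)) \<le> b * ennreal (t powr - \<delta>) * ennreal (1 / (1 - w))"
  proof -
    have "emeasure N (\<Union>k. L (?h k)) \<le> (\<Sum>k. emeasure N (L (?h k)))"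
      by (rule emeasure_subadditive_countably) auto
    also have "\<dots> \<le> (\<Sum>k. b * ennreal (t powr - \<delta>) * ennreal (w ^ k))"
    proof (rule suminf_le)
      fix k
      have "emeasure N (L (?h k)) \<le> b * ennreal ((?h k) powr - \<delta>)"
        unfolding L_def using t by (intro high) simp
      also have "(?h k) powr - \<delta> = t powr - \<delta> * w ^ k"
        using t by (simp add: powr_mult powr_powr w_pow[symmetric] mult.commute)
      finally show "emeasure N (L (?h k)) \<le> b * ennreal (t powr - \<delta>) * ennreal (w ^ k)"
        using w by (simp add: ennreal_mult mult.assoc)
    qed auto
    finally show ?thesis by (simp only: suminf_geometric_ennreal[OF w])
  qed
  have "{y \<in> space N. 0 < \<phi> y} \<subseteq> (\<Union>k. L (?n k)) \<union> (\<Union>k. L (?h k))"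
    using dyadic_layer_exists[OF _ t] by (fastforce simp: L_def)
  then have "emeasure N {y \<in> space N. 0 < \<phi> y} \<le> emeasure N ((\<Union>k. L (?n k)) \<union> (\<Union>k. L (?h k)))"
    by (intro emeasure_mono) auto
  also have "\<dots> \<le> emeasure N (\<Union>k. L (?n k)) + emeasure N (\<Union>k. L (?h k))"
    by (intro emeasure_subadditive) auto
  also have "\<dots> \<le> a * ennreal (t powr \<delta>) * ennreal (1 / (1 - w))
      + b * ennreal (t powr - \<delta>) * ennreal (1 / (1 - w))"
    by (intro add_mono near far)
  finally show ?thesis by (simp add: w_def ring_distribs mult_ac)
qed

text \<open>
  For finite nonzero \<open>a\<close> and \<open>b\<close> the balancing threshold satisfies \<open>t\<^sup>\<delta> = (b/a)\<^bsup>1/2\<^esup>\<close>. If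
  one of them is \<open>0\<close>, the right-hand side is \<open>0\<close> even when the other is \<open>\<infinity>\<close>; the bound
  still holds, because then every single layer is null.
\<close>

lemma dyadic_layers_interpolate:
  fixes \<phi> :: "'a \<Rightarrow> real" and a b :: ennreal
  assumes meas: "\<phi> \<in> borel_measurable N" and \<delta>: "0 < \<delta>" and K: "0 < K"
    and low: "\<And>s. 0 < s \<Longrightarrow>
        emeasure N {y \<in> space N. s < \<phi> y \<and> \<phi> y \<le> 2 * s} \<le> a * ennreal (K * s powr \<delta>)"
    and high: "\<And>s. 0 < s \<Longrightarrow>
        emeasure N {y \<in> space N. s < \<phi> y \<and> \<phi> y \<le> 2 * s} \<le> b * ennreal (K * s powr - \<delta>)"
  shows "emeasure N {y \<in> space N. 0 < \<phi> y}
    \<le> ennreal (2 * K / (1 - 2 powr - \<delta>)) * ennreal_powr (a * b) (1 / 2)"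
proof -
  have "2 powr - \<delta> < (1::real)" using \<delta> by (simp add: powr_less_one)
  then have G: "0 < 1 - (2::real) powr - \<delta>" by simp
  consider "a = 0 \<or> b = 0" | "a \<noteq> 0" "b \<noteq> 0" "a = top \<or> b = top"
    | "a \<noteq> 0" "b \<noteq> 0" "a \<noteq> top" "b \<noteq> top" by blast
  then show ?thesis
  proof cases
    case 1
    then have "emeasure N {y \<in> space N. s < \<phi> y \<and> \<phi> y \<le> 2 * s} = 0" if "0 < s" for s
      using low[OF that] high[OF that] by auto
    then have "emeasure N {y \<in> space N. 0 < \<phi> y} \<le> 0"
      using dyadic_layers_sum[OF meas \<delta>, of 1 0 0] by simp
    then show ?thesis by simp
  next
    case 2
    then have "a * b = top" by (auto simp: ennreal_mult_eq_top_iff)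
    then show ?thesis using G K \<delta> by (simp add: ennreal_powr_def ennreal_mult_top)
  next
    case 3
    then obtain a' b' where ab: "a = ennreal a'" "b = ennreal b'" "0 < a'" "0 < b'"
      by (cases a; cases b) (auto simp: zero_less_iff_neq_zero less_le)
    define t where "t = (b' / a') powr (1 / (2 * \<delta>))"
    have t: "0 < t" using ab by (simp add: t_def)
    have td: "t powr \<delta> = sqrt b' / sqrt a'" "t powr - \<delta> = sqrt a' / sqrt b'"
      using ab \<delta> by (simp_all add: t_def powr_powr powr_minus powr_half_sqrt real_sqrt_divide)
    have "emeasure N {y \<in> space N. 0 < \<phi> y} \<le> ennreal (1 / (1 - 2 powr - \<delta>)) *
        (a * ennreal K * ennreal (t powr \<delta>) + b * ennreal K * ennreal (t powr - \<delta>))"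
      using low high K by (intro dyadic_layers_sum meas \<delta> t) (simp_all add: ennreal_mult mult.assoc)
    also have "\<dots> = ennreal (1 / (1 - 2 powr - \<delta>) *
        (a' * K * (t powr \<delta>) + b' * K * (t powr - \<delta>)))"
      using ab K G by (simp add: ennreal_mult[symmetric] ennreal_plus[symmetric] del: ennreal_plus)
    also have "a' * K * (t powr \<delta>) + b' * K * (t powr - \<delta>) = 2 * K * (sqrt a' * sqrt b')"
    proof -
      have "a' * (sqrt b' / sqrt a') = sqrt a' * sqrt b'" "b' * (sqrt a' / sqrt b') = sqrt a' * sqrt b'"
        using ab by (simp_all add: field_simps)
      then show ?thesis unfolding td by algebra
    qed
    also have "ennreal (1 / (1 - 2 powr - \<delta>) * (2 * K * (sqrt a' * sqrt b')))
        = ennreal (2 * K / (1 - 2 powr - \<delta>)) * ennreal_powr (a * b) (1 / 2)"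
    proof -
      have "ennreal_powr (a * b) (1 / 2) = ennreal (sqrt a' * sqrt b')"
        using ab by (simp add: ennreal_powr_def ennreal_mult[symmetric] powr_half_sqrt real_sqrt_mult)
      then show ?thesis using ab K G by (simp add: ennreal_mult[symmetric])
    qed
    finally show ?thesis .
  qed
qed

section \<open>The kernel of the fractional integral\<close>

text \<open>
  Bounding the two parts separately suffices: their difference is at most the larger of them,
  and if both are \<open>\<infinity>\<close>, then so is \<open>J\<close>.
\<close>

lemma abs_ext_set_integral_le:
  assumes "(\<integral>\<^sup>+y\<in>A. e2ennreal (g y) \<partial>M) \<le> J" "(\<integral>\<^sup>+y\<in>A. e2ennreal (- g y) \<partial>M) \<le> J"
  shows "\<bar>ext_set_integral M A g\<bar> \<le> enn2ereal J"
proof -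
  have *: "\<bar>enn2ereal P - enn2ereal Q\<bar> \<le> enn2ereal J" if "P \<le> J" "Q \<le> J" for P Q
    using that by (cases P; cases Q; cases J) (auto simp: top_unique)
  show ?thesis unfolding ext_set_integral_def by (rule *[OF assms])
qed

lemma powr_le_of_Ahlfors:
  fixes c r v :: real
  assumes "0 < c" "0 < r" "0 < \<beta>" "0 < \<alpha>" and le: "c * (r / 2) powr \<beta> \<le> v"
  shows "r powr \<alpha> \<le> 2 powr \<alpha> * c powr - (\<alpha> / \<beta>) * v powr (\<alpha> / \<beta>)"
proof -
  have "(r / 2) powr \<alpha> = ((r / 2) powr \<beta>) powr (\<alpha> / \<beta>)"
    using assms by (simp add: powr_powr)
  also have "\<dots> \<le> (v / c) powr (\<alpha> / \<beta>)"
    using assms by (intro powr_mono2) (auto simp: field_simps)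
  also have "\<dots> = c powr - (\<alpha> / \<beta>) * v powr (\<alpha> / \<beta>)"
  proof -
    have "0 \<le> c * (r / 2) powr \<beta>" using assms by simp
    then have "0 \<le> v" using le by linarith
    then show ?thesis using \<open>0 < c\<close> by (simp add: powr_divide powr_minus_divide)
  qed
  finally have "2 powr \<alpha> * (r / 2) powr \<alpha>
      \<le> 2 powr \<alpha> * (c powr - (\<alpha> / \<beta>) * v powr (\<alpha> / \<beta>))"
    by (rule mult_left_mono) simp
  then show ?thesis using \<open>0 < r\<close> by (simp add: powr_divide mult.assoc)
qed

text \<open>
  The cube \<open>Q(x, 2r)\<close> with \<open>r = |x - y|\<close> can be too large for the regularity hypothesis, which
  concerns side lengths below \<open>diameter \<Omega>\<close>. Since \<open>r \<le> diameter \<Omega>\<close>, the cube \<open>Q(x, r/2)\<close>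
  inside it always qualifies. The free value \<open>z = \<plusminus> f y\<close> covers both the positive and the
  negative part of the integral.
\<close>

lemma kernel_le_cube_mass_powr:
  fixes x y :: "real^'n"
  assumes B: "sets borel \<subseteq> sets M"
    and xy: "x \<in> \<Omega>" "y \<in> \<Omega>" and "bounded \<Omega>" and c: "0 < c"
    and Ahlfors: "\<And>l. 0 < l \<Longrightarrow> l < diameter \<Omega> \<Longrightarrow> ennreal (c * l powr \<beta>) \<le> emeasure M (cube x l)"
    and \<beta>: "0 < \<beta>" and \<alpha>: "0 < \<alpha>" and z: "\<bar>z\<bar> = \<bar>f y\<bar>"
  shows "e2ennreal (ereal (z * norm (x - y) powr \<alpha>)
            / enn2ereal (emeasure M (cube x (2 * norm (x - y)))))
    \<le> ennreal (2 powr \<alpha> * c powr - (\<alpha> / \<beta>))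
        * ennreal (\<bar>f y\<bar> * cube_mass M x y powr - (1 - \<alpha> / \<beta>))"
proof (cases "y = x \<or> emeasure M (cube x (2 * norm (x - y))) = top")
  case True
  then show ?thesis using \<alpha> by (auto simp: zero_ereal_def[symmetric] e2ennreal_neg)
next
  case False
  define r where "r = norm (x - y)"
  define v where "v = cube_mass M x y"
  have r: "0 < r" using False by (auto simp: r_def)
  have em: "emeasure M (cube x (2 * r)) = ennreal v"
    using False by (simp add: v_def r_def cube_mass_def less_top)
  have "r \<le> diameter \<Omega>"
    using diameter_bounded_bound[OF \<open>bounded \<Omega>\<close> xy] by (simp add: r_def dist_norm)
  then have "ennreal (c * (r / 2) powr \<beta>) \<le> emeasure M (cube x (r / 2))"
    using r by (intro Ahlfors) auto
  also have "\<dots> \<le> emeasure M (cube x (2 * r))"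
    using r B borel_closed[OF closed_cube] by (intro emeasure_mono cube_mono) auto
  finally have le: "c * (r / 2) powr \<beta> \<le> v"
    using c by (simp add: em v_def)
  moreover have "0 < c * (r / 2) powr \<beta>" using c r by simp
  ultimately have v: "0 < v" by linarith
  have "z * r powr \<alpha> / v \<le> \<bar>f y\<bar> * r powr \<alpha> / v"
    using v z by (intro divide_right_mono mult_right_mono) auto
  also have "\<dots> \<le> \<bar>f y\<bar> * (2 powr \<alpha> * c powr - (\<alpha> / \<beta>) * v powr (\<alpha> / \<beta>)) / v"
    using v powr_le_of_Ahlfors[OF c r \<beta> \<alpha> le] by (intro divide_right_mono mult_left_mono) auto
  also have "\<dots> = 2 powr \<alpha> * c powr - (\<alpha> / \<beta>) * (\<bar>f y\<bar> * v powr - (1 - \<alpha> / \<beta>))"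
    using v by (simp add: powr_diff)
  finally have "ennreal (z * r powr \<alpha> / v)
      \<le> ennreal (2 powr \<alpha> * c powr - (\<alpha> / \<beta>) * (\<bar>f y\<bar> * v powr - (1 - \<alpha> / \<beta>)))"
    by (rule ennreal_leI)
  also have "\<dots> = ennreal (2 powr \<alpha> * c powr - (\<alpha> / \<beta>)) * ennreal (\<bar>f y\<bar> * v powr - (1 - \<alpha> / \<beta>))"
    using c by (intro ennreal_mult) auto
  finally show ?thesis
    using v by (simp add: r_def[symmetric] em v_def[symmetric])
qed

section \<open>The pointwise estimate\<close>

theorem lemma2p9:
  fixes M :: "(real^'n) measure" and \<Omega> :: "(real^'n) set" and \<alpha> \<beta> \<epsilon> :: real
  assumes "borel_regular M"
    and "bounded \<Omega>" and "\<Omega> \<in> sets M"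
    and "\<beta> > 0" and "lower_Ahlfors_regular M \<beta> \<Omega>"
    and "0 < \<alpha>" and "\<alpha> < \<beta>"
    and "0 < \<epsilon>" and "\<epsilon> < min \<alpha> (\<beta> - \<alpha>)"
  shows "\<exists>C::real. C > 0 \<and>
    (\<forall>f :: real^'n \<Rightarrow> real. locally_integrable M f \<and> (\<forall>y. y \<notin> \<Omega> \<longrightarrow> f y = 0) \<longrightarrow>
      (\<forall>x\<in>\<Omega>. \<bar>frac_integral M \<Omega> \<alpha> f x\<bar>
        \<le> enn2ereal (ennreal C *
            ennreal_powr (frac_maximal M \<beta> (\<alpha> + \<epsilon>) f x * frac_maximal M \<beta> (\<alpha> - \<epsilon>) f x) (1 / 2))))"
proof -
  have B: "sets borel \<subseteq> sets M" using assms(1) by (simp add: borel_regular_def)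
  obtain c where c: "0 < c" and Ahlfors: "\<And>x l. x \<in> \<Omega> \<Longrightarrow> 0 < l \<Longrightarrow> l < diameter \<Omega> \<Longrightarrow>
      ennreal (c * l powr \<beta>) \<le> emeasure M (cube x l)"
    using assms(5) unfolding lower_Ahlfors_regular_def by blast
  define p \<delta> where "p = 1 - \<alpha> / \<beta>" and "\<delta> = \<epsilon> / \<beta>"
  \<comment> \<open>The layer estimates come with the factors \<open>2 powr (p \<plusminus> \<delta>)\<close>; \<open>K\<close> is the larger one.\<close>
  define K D where "K = 2 powr (p + \<delta>)" and "D = 2 powr \<alpha> * c powr - (\<alpha> / \<beta>)"
  define C where "C = D * (2 * K / (1 - 2 powr - \<delta>))"
  have \<delta>: "0 < \<delta>" "\<delta> \<le> p" "0 \<le> p"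
    using assms(4,6-9) by (auto simp: p_def \<delta>_def field_simps)
  have exps: "1 - (\<alpha> - \<epsilon>) / \<beta> = p + \<delta>" "1 - (\<alpha> + \<epsilon>) / \<beta> = p - \<delta>"
    by (simp_all add: p_def \<delta>_def add_divide_distrib diff_divide_distrib)
  have K: "0 < K" "2 powr (p - \<delta>) \<le> K" using \<delta> by (simp_all add: K_def)
  have D: "0 < D" using c by (simp add: D_def)
  have "2 powr - \<delta> < (1::real)" using \<delta> by (simp add: powr_less_one)
  then have C: "0 < C" using D K by (simp add: C_def)
  have "\<bar>frac_integral M \<Omega> \<alpha> f x\<bar> \<le> enn2ereal (ennreal C *
      ennreal_powr (frac_maximal M \<beta> (\<alpha> + \<epsilon>) f x * frac_maximal M \<beta> (\<alpha> - \<epsilon>) f x) (1 / 2))"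
    if f: "locally_integrable M f" and x: "x \<in> \<Omega>" for f x
  proof -
    have fm[measurable]: "f \<in> borel_measurable M" using f by (simp add: locally_integrable_def)
    note [measurable] = borel_measurable_cube_mass[OF B, of x]
    let ?\<phi> = "cube_mass M x"
    define F where "F y = ennreal (\<bar>f y\<bar> * ?\<phi> y powr - p)" for y
    have [measurable]: "F \<in> borel_measurable M" unfolding F_def by measurable
    define N where "N = density M F"
    note space_M = space_UNIV_of_borel_sub[OF B]
    have layer: "emeasure N {y \<in> space N. s < ?\<phi> y \<and> ?\<phi> y \<le> 2 * s}
        \<le> frac_maximal M \<beta> \<gamma> f x * ennreal (2 powr (1 - \<gamma> / \<beta>) * s powr (1 - \<gamma> / \<beta> - p))"
      if "0 < s" "0 \<le> 1 - \<gamma> / \<beta>" for s \<gamma>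
    proof -
      have "{y \<in> space M. s < ?\<phi> y \<and> ?\<phi> y \<le> 2 * s} \<in> sets M" by measurable
      then have "emeasure N {y. s < ?\<phi> y \<and> ?\<phi> y \<le> 2 * s}
          = (\<integral>\<^sup>+y. F y * indicator {y. s < ?\<phi> y \<and> ?\<phi> y \<le> 2 * s} y \<partial>M)"
        unfolding N_def space_M by (intro emeasure_density) auto
      then show ?thesis
        using dyadic_layer_integral_le[OF B fm that(2) \<delta>(3) that(1)]
        by (simp add: N_def space_M F_def)
    qed
    have total: "emeasure N {y \<in> space N. 0 < ?\<phi> y} \<le> ennreal (2 * K / (1 - 2 powr - \<delta>)) *
        ennreal_powr (frac_maximal M \<beta> (\<alpha> - \<epsilon>) f x * frac_maximal M \<beta> (\<alpha> + \<epsilon>) f x) (1 / 2)"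
    proof (rule dyadic_layers_interpolate[OF _ \<delta>(1) K(1)])
      show "?\<phi> \<in> borel_measurable N" unfolding N_def by measurable
    next
      fix s :: real assume s: "0 < s"
      show "emeasure N {y \<in> space N. s < ?\<phi> y \<and> ?\<phi> y \<le> 2 * s}
          \<le> frac_maximal M \<beta> (\<alpha> - \<epsilon>) f x * ennreal (K * s powr \<delta>)"
        using layer[OF s, of "\<alpha> - \<epsilon>"] \<delta> by (simp add: exps K_def)
      have "emeasure N {y \<in> space N. s < ?\<phi> y \<and> ?\<phi> y \<le> 2 * s}
          \<le> frac_maximal M \<beta> (\<alpha> + \<epsilon>) f x * ennreal (2 powr (p - \<delta>) * s powr - \<delta>)"
        using layer[OF s, of "\<alpha> + \<epsilon>"] \<delta> by (simp add: exps)
      also have "\<dots> \<le> frac_maximal M \<beta> (\<alpha> + \<epsilon>) f x * ennreal (K * s powr - \<delta>)"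
        using K(2) by (intro mult_left_mono ennreal_leI mult_right_mono) auto
      finally show "emeasure N {y \<in> space N. s < ?\<phi> y \<and> ?\<phi> y \<le> 2 * s}
          \<le> frac_maximal M \<beta> (\<alpha> + \<epsilon>) f x * ennreal (K * s powr - \<delta>)" .
    qed
    have "{y \<in> space M. 0 < ?\<phi> y} \<in> sets M" by measurable
    then have "emeasure N {y \<in> space N. 0 < ?\<phi> y}
        = (\<integral>\<^sup>+y. F y * indicator {y. 0 < ?\<phi> y} y \<partial>M)"
      unfolding N_def by (simp add: space_M emeasure_density)
    also have "\<dots> = (\<integral>\<^sup>+y. F y \<partial>M)"
    proof (rule nn_integral_cong)
      fix y
      have "F y = 0" if "\<not> 0 < ?\<phi> y"
      proof -
        have "?\<phi> y = 0" using that cube_mass_nonneg[of M x y] by linarith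
        then show ?thesis by (simp add: F_def)
      qed
      then show "F y * indicator {y. 0 < ?\<phi> y} y = F y" by (auto split: split_indicator)
    qed
    finally have F_total: "(\<integral>\<^sup>+y. F y \<partial>M) = emeasure N {y \<in> space N. 0 < ?\<phi> y}" ..
    have part: "(\<integral>\<^sup>+y\<in>\<Omega>. e2ennreal (ereal (g y * norm (x - y) powr \<alpha>)
          / enn2ereal (emeasure M (cube x (2 * norm (x - y))))) \<partial>M) \<le> ennreal D * (\<integral>\<^sup>+y. F y \<partial>M)"
      if g: "\<And>y. \<bar>g y\<bar> = \<bar>f y\<bar>" for g
    proof -
      have "(\<integral>\<^sup>+y\<in>\<Omega>. e2ennreal (ereal (g y * norm (x - y) powr \<alpha>)
          / enn2ereal (emeasure M (cube x (2 * norm (x - y))))) \<partial>M) \<le> (\<integral>\<^sup>+y. ennreal D * F y \<partial>M)"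
      proof (rule nn_integral_mono)
        fix y
        show "e2ennreal (ereal (g y * norm (x - y) powr \<alpha>)
            / enn2ereal (emeasure M (cube x (2 * norm (x - y))))) * indicator \<Omega> y \<le> ennreal D * F y"
          using kernel_le_cube_mass_powr[OF B x _ assms(2) c Ahlfors[OF x] assms(4,6), of y "g y" f] g
          by (auto simp: F_def D_def p_def split: split_indicator)
      qed
      also have "\<dots> = ennreal D * (\<integral>\<^sup>+y. F y \<partial>M)" by (rule nn_integral_cmult) measurable
      finally show ?thesis .
    qed
    have "\<bar>frac_integral M \<Omega> \<alpha> f x\<bar> \<le> enn2ereal (ennreal D * (\<integral>\<^sup>+y. F y \<partial>M))"
      unfolding frac_integral_def
    proof (rule abs_ext_set_integral_le)
      show "(\<integral>\<^sup>+y\<in>\<Omega>. e2ennreal (ereal (f y * norm (x - y) powr \<alpha>)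
          / enn2ereal (emeasure M (cube x (2 * norm (x - y))))) \<partial>M) \<le> ennreal D * (\<integral>\<^sup>+y. F y \<partial>M)"
        by (rule part) simp
      show "(\<integral>\<^sup>+y\<in>\<Omega>. e2ennreal (- (ereal (f y * norm (x - y) powr \<alpha>)
          / enn2ereal (emeasure M (cube x (2 * norm (x - y)))))) \<partial>M) \<le> ennreal D * (\<integral>\<^sup>+y. F y \<partial>M)"
        using part[of "\<lambda>y. - f y"] by (simp add: divide_ereal_def flip: ereal_mult_minus_left uminus_ereal.simps(1))
    qed
    also have "\<dots> \<le> enn2ereal (ennreal D * (ennreal (2 * K / (1 - 2 powr - \<delta>)) *
        ennreal_powr (frac_maximal M \<beta> (\<alpha> - \<epsilon>) f x * frac_maximal M \<beta> (\<alpha> + \<epsilon>) f x) (1 / 2)))"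
      using total unfolding F_total less_eq_ennreal.rep_eq[symmetric] by (intro mult_left_mono) auto
    also have "\<dots> = enn2ereal (ennreal C *
      ennreal_powr (frac_maximal M \<beta> (\<alpha> + \<epsilon>) f x * frac_maximal M \<beta> (\<alpha> - \<epsilon>) f x) (1 / 2))"
      using D unfolding C_def by (subst ennreal_mult') (simp_all only: less_imp_le mult_ac)
    finally show ?thesis .
  qed
  then show ?thesis using C by blast
qed

end
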